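(* Let $(X,d,\mu)$ be a space of homogeneous type and let $\{\psi_\alpha^k\}_{k\in\mathbb{Z},\,\alpha\in\mathscr{Y}^k}$ be an orthonormal (Auscher--Hytönen) wavelet basis of $L^2(X)$ with Hölder regularity of order $\eta$, as described in the context. Then for each $k\in\mathbb{Z}$, each $y_\alpha^k\in\mathscr{Y}^k$ and each $\gamma>0$, the scaled wavelet $$x\mapsto \frac{\psi_\alpha^k(x)}{\sqrt{\mu(B(y_\alpha^k,\delta^k))}}$$ belongs to the set $G(y_\alpha^k,\delta^k,\eta,\gamma)$ of test functions of type $(y_\alpha^k,\delta^k,\eta,\gamma)$ centered at $y_\alpha^k$.
   Context: Space of homogeneous type: $(X,d,\mu)$ where $d$ is a quasi-metric on $X$ ($d(x,y)=d(y,x)\ge 0$, $d(x,y)=0$ iff $x=y$, and $d(x,y)\le A_0[d(x,z)+d(z,y)]$ for a constant $A_0\ge 1$), and $\mu$ is a nonzero measure with $\mu(B(x,2r))\le C_\mu\,\mu(B(x,r))<\infty$ for all $x\in X$, $r>0$, where $B(x,r)=\{y: d(x,y)<r\}$. Standing assumptions: $\mu(X)=\infty$ and $\mu(B(x,r))>0$ for all $x\in X$, $r>0$. No further assumptions on $d$ or $\mu$. Notation: $V_r(x)=\mu(B(x,r))$, $V(x,y)=\mu(B(x,d(x,y)))$. Reference dyadic points: fix a small $\delta\in(0,1)$ (e.g. $\delta\le 10^{-3}A_0^{-10}$). $\mathscr{X}^0$ is a maximal collection of $1$-separated points of $X$; inductively for $k\ge1$, $\mathscr{X}^k\supseteq\mathscr{X}^{k-1}$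 and $\mathscr{X}^{-k}\subseteq\mathscr{X}^{-(k-1)}$ are maximal $\delta^k$- and $\delta^{-k}$-separated collections in $X$ and $\mathscr{X}^{-(k-1)}$ respectively. Thus distinct points of $\mathscr{X}^k=\{x_\alpha^k\}_\alpha$ are at distance $\ge\delta^k$ and $\min_\alpha d(x,x_\alpha^k)<2A_0\delta^k$ for all $x\in X$. Put $\mathscr{Y}^k=\mathscr{X}^{k+1}\setminus\mathscr{X}^k$, with points denoted $y_\alpha^k$ (indices $\alpha$ are identified with points). Wavelets: $\{\psi_\alpha^k\}_{k\in\mathbb{Z},\alpha\in\mathscr{Y}^k}$ is an orthonormal basis of $L^2(X)$ such that, with $a=(1+2\log_2A_0)^{-1}$ and constants $C<\infty$, $\nu>0$, $\eta\in(0,1]$ independent of $k,\alpha,x,y$: $|\psi_\alpha^k(x)|\le C\mu(B(y_\alpha^k,\delta^k))^{-1/2}\exp(-\nu(d(y_\alpha^k,x)/\delta^k)^a)$; $|\psi_\alpha^k(x)-\psi_\alpha^k(y)|\le C\mu(B(y_\alpha^k,\delta^k))^{-1/2}(d(x,y)/\delta^k)^\eta\exp(-\nu(d(y_\alpha^k,x)/\delta^k)^a)$ whenever $d(x,y)\le\delta^k$; and $\int_X\psi_\alpha^k\,d\mu=0$. Test functions: for $x_0\in X$, $r>0$, $\beta\in(0,\eta]$, $\gamma>0$, $G(x_0,r,\beta,\gamma)$ is the set of functions $f$ on $X$ for which there is $C>0$ with (i) $|f(x)|\le C\frac{1}{V_r(x_0)+V(x,x_0)}\big(\frac{r}{r+d(x,x_0)}\big)^\gamma$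 for all $x\in X$; (ii) $|f(x)-f(y)|\le C\big(\frac{d(x,y)}{r+d(x,x_0)}\big)^\beta\frac{1}{V_r(x_0)+V(x,x_0)}\big(\frac{r}{r+d(x,x_0)}\big)^\gamma$ for all $x,y$ with $d(x,y)<(2A_0)^{-1}(r+d(x,x_0))$; and (iii) $\int_X f\,d\mu=0$. *)

theory Defs
  imports "HOL-Analysis.Analysis"
begin

(* The underlying set X is space M throughout. *)

definition qball :: "'a measure \<Rightarrow> ('a \<Rightarrow> 'a \<Rightarrow> real) \<Rightarrow> 'a \<Rightarrow> real \<Rightarrow> 'a set" where
  "qball M d x r = {y \<in> space M. d x y < r}"

(* Real-valued; nothing is lost because balls have finite measure in a space of homogeneous type. *)
definition vol :: "'a measure \<Rightarrow> ('a \<Rightarrow> 'a \<Rightarrow> real) \<Rightarrow> 'a \<Rightarrow> real \<Rightarrow> real" where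
  "vol M d x r = measure M (qball M d x r)"

(* Space of homogeneous type with the standing assumptions of infinite total measure (so the measure
   is nonzero) and balls of positive measure. Measurability of balls is what gives their measure a
   meaning; no relation between the sigma-algebra and a topology is assumed. *)
locale homogeneous_type_space =
  fixes M :: "'a measure" and d :: "'a \<Rightarrow> 'a \<Rightarrow> real" and A0 :: real
  assumes A0_ge_1: "1 \<le> A0"
    and d_nonneg: "x \<in> space M \<Longrightarrow> y \<in> space M \<Longrightarrow> 0 \<le> d x y"
    and d_sym: "x \<in> space M \<Longrightarrow> y \<in> space M \<Longrightarrow> d x y = d y x"
    and d_zero_iff: "x \<in> space M \<Longrightarrow> y \<in> space M \<Longrightarrow> d x y = 0 \<longleftrightarrow> x = y"
    and d_quasi_triangle:
      "x \<in> space M \<Longrightarrow> y \<in> space M \<Longrightarrow> z \<in> space M \<Longrightarrow> d x y \<le> A0 * (d x z + d z y)"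
    and qball_sets: "x \<in> space M \<Longrightarrow> 0 < r \<Longrightarrow> qball M d x r \<in> sets M"
    and doubling: "\<exists>C::real. \<forall>x\<in>space M. \<forall>r>0.
      emeasure M (qball M d x (2 * r)) \<le> ennreal C * emeasure M (qball M d x r)"
    and qball_finite: "x \<in> space M \<Longrightarrow> 0 < r \<Longrightarrow> emeasure M (qball M d x r) < \<infinity>"
    and qball_positive: "x \<in> space M \<Longrightarrow> 0 < r \<Longrightarrow> 0 < emeasure M (qball M d x r)"
    and infinite_measure: "emeasure M (space M) = \<infinity>"

definition separated_set :: "('a \<Rightarrow> 'a \<Rightarrow> real) \<Rightarrow> real \<Rightarrow> 'a set \<Rightarrow> bool" where
  "separated_set d r S \<longleftrightarrow> (\<forall>x\<in>S. \<forall>y\<in>S. x \<noteq> y \<longrightarrow> r \<le> d x y)"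

definition maximal_separated :: "('a \<Rightarrow> 'a \<Rightarrow> real) \<Rightarrow> real \<Rightarrow> 'a set \<Rightarrow> 'a set \<Rightarrow> bool" where
  "maximal_separated d r E S \<longleftrightarrow>
     S \<subseteq> E \<and> separated_set d r S \<and> (\<forall>T. S \<subseteq> T \<and> T \<subseteq> E \<and> separated_set d r T \<longrightarrow> T = S)"

definition reference_points ::
  "'a measure \<Rightarrow> ('a \<Rightarrow> 'a \<Rightarrow> real) \<Rightarrow> real \<Rightarrow> (int \<Rightarrow> 'a set) \<Rightarrow> bool" where
  "reference_points M d \<delta> Xp \<longleftrightarrow>
     maximal_separated d 1 (space M) (Xp 0) \<and>
     (\<forall>k\<ge>1. Xp (k - 1) \<subseteq> Xp k \<and> maximal_separated d (\<delta> powi k) (space M) (Xp k)) \<and>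
     (\<forall>k\<ge>1. maximal_separated d (\<delta> powi (- k)) (Xp (- (k - 1))) (Xp (- k)))"

definition wavelet_centers :: "(int \<Rightarrow> 'a set) \<Rightarrow> int \<Rightarrow> 'a set" where
  "wavelet_centers Xp k = Xp (k + 1) - Xp k"

(* Functions, not almost-everywhere classes: the pointwise wavelet estimates concern
   actual representatives. *)
definition L2 :: "'a measure \<Rightarrow> ('a \<Rightarrow> complex) set" where
  "L2 M = {f \<in> borel_measurable M. integrable M (\<lambda>x. (cmod (f x))\<^sup>2)}"

definition L2_inner :: "'a measure \<Rightarrow> ('a \<Rightarrow> complex) \<Rightarrow> ('a \<Rightarrow> complex) \<Rightarrow> complex" where
  "L2_inner M f g = (\<integral>x. f x * cnj (g x) \<partial>M)"

(* Orthonormal family whose finite linear combinations are dense in L2. *)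
definition orthonormal_basis_L2 :: "'a measure \<Rightarrow> 'i set \<Rightarrow> ('i \<Rightarrow> 'a \<Rightarrow> complex) \<Rightarrow> bool" where
  "orthonormal_basis_L2 M I e \<longleftrightarrow>
     (\<forall>i\<in>I. e i \<in> L2 M) \<and>
     (\<forall>i\<in>I. \<forall>j\<in>I. L2_inner M (e i) (e j) = (if i = j then 1 else 0)) \<and>
     (\<forall>f\<in>L2 M. \<forall>\<epsilon>>0. \<exists>F c. finite F \<and> F \<subseteq> I \<and>
        (\<integral>x. (cmod (f x - (\<Sum>i\<in>F. c i * e i x)))\<^sup>2 \<partial>M) < \<epsilon>)"

(* The wavelet with indices k and y (the latter a point of wavelet_centers Xp k) is psi k y. *)
definition wavelet_basis ::
  "'a measure \<Rightarrow> ('a \<Rightarrow> 'a \<Rightarrow> real) \<Rightarrow> real \<Rightarrow> real \<Rightarrow> (int \<Rightarrow> 'a set) \<Rightarrow> real \<Rightarrow>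
   (int \<Rightarrow> 'a \<Rightarrow> 'a \<Rightarrow> complex) \<Rightarrow> bool" where
  "wavelet_basis M d A0 \<delta> Xp \<eta> \<psi> \<longleftrightarrow>
     orthonormal_basis_L2 M (SIGMA k:UNIV. wavelet_centers Xp k) (\<lambda>(k, y). \<psi> k y) \<and>
     (\<exists>C \<nu>. 0 < \<nu> \<and>
       (let a = inverse (1 + 2 * log 2 A0) in
        \<forall>k. \<forall>y\<in>wavelet_centers Xp k.
          (\<forall>x\<in>space M.
             cmod (\<psi> k y x) \<le> C * vol M d y (\<delta> powi k) powr (- 1 / 2) *
               exp (- \<nu> * (d y x / \<delta> powi k) powr a)) \<and>
          (\<forall>x\<in>space M. \<forall>z\<in>space M. d x z \<le> \<delta> powi k \<longrightarrow>
             cmod (\<psi> k y x - \<psi> k y z) \<le> C * vol M d y (\<delta> powi k) powr (- 1 / 2) *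
               (d x z / \<delta> powi k) powr \<eta> * exp (- \<nu> * (d y x / \<delta> powi k) powr a)))) \<and>
     (\<forall>k. \<forall>y\<in>wavelet_centers Xp k. has_bochner_integral M (\<psi> k y) 0)"

(* The class G(x0, r, beta, gamma). The cancellation condition includes integrability, since the
   integral of a non-integrable function is 0 by convention. *)
definition test_functions ::
  "'a measure \<Rightarrow> ('a \<Rightarrow> 'a \<Rightarrow> real) \<Rightarrow> real \<Rightarrow> 'a \<Rightarrow> real \<Rightarrow> real \<Rightarrow> real \<Rightarrow> ('a \<Rightarrow> complex) set" where
  "test_functions M d A0 x0 r \<beta> \<gamma> =
     {f. (\<exists>C>0.
            (\<forall>x\<in>space M.
               cmod (f x) \<le> C * (1 / (vol M d x0 r + vol M d x (d x x0))) *
                 (r / (r + d x x0)) powr \<gamma>) \<and>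
            (\<forall>x\<in>space M. \<forall>y\<in>space M. d x y < inverse (2 * A0) * (r + d x x0) \<longrightarrow>
               cmod (f x - f y) \<le> C * (d x y / (r + d x x0)) powr \<beta> *
                 (1 / (vol M d x0 r + vol M d x (d x x0))) * (r / (r + d x x0)) powr \<gamma>)) \<and>
         has_bochner_integral M f 0}"

end

theory Submission
  imports Defs
begin

text \<open>
  Write \<open>r = \<delta>\<^sup>k\<close>, \<open>V\<close> for the measure of the ball of radius \<open>r\<close> about the center \<open>y\<close>, and
  \<open>P = 1 + d(x, y) / r\<close>.  The two weights in the definition of a test function cost only powers of
  \<open>P\<close>: the factor \<open>(r / (r + d(x, y)))\<^sup>\<gamma>\<close> is \<open>P\<close> to the power \<open>-\<gamma>\<close>, and by iterated doubling
  (\<open>vol_scale_le\<close>) the sum of the two volumes is at most a constant times \<open>P\<^sup>m V\<close>, so that \<open>1 / V\<close>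
  is bounded by a power of \<open>P\<close> times the weight (\<open>inverse_vol_le_weight\<close>).  The stretched
  exponential in the wavelet bounds beats every power of \<open>P\<close> (\<open>powr_times_stretched_exp_bounded\<close>),
  and dividing the wavelet by \<open>\<surd>V\<close> turns its normalization \<open>V\<^sup>-\<^sup>1\<^sup>/\<^sup>2\<close> into the required \<open>1 / V\<close>.

  The Hoelder condition of order \<open>\<beta>\<close> for a test function is asked for \<open>d(x, z) < (r + d(x, y)) / (2 A0)\<close>, whereas
  the wavelet estimate covers only \<open>d(x, z) \<le> r\<close>.  For \<open>d(x, z) > r\<close> no smoothness is needed: there
  \<open>(d(x, z) / (r + d(x, y)))\<^sup>\<beta>\<close> is at least \<open>P\<close> to the power \<open>-\<beta>\<close>, and the size bounds at \<open>x\<close> and at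
  \<open>z\<close> absorb this loss, because by the quasi-triangle inequality the restriction on \<open>d(x, z)\<close> gives
  \<open>P \<le> 2 A0 (1 + d(z, y) / r)\<close>, so that decay in \<open>d(z, y)\<close> is as good as decay in \<open>d(x, y)\<close>.
\<close>

section \<open>Stretched exponentials against powers\<close>

lemma powr_times_stretched_exp_bounded:
  fixes a \<nu> s :: real
  assumes "0 < a" "0 < \<nu>" "0 \<le> s"
  obtains E where "0 < E" "\<And>t. 0 \<le> t \<Longrightarrow> (1 + t) powr s * exp (- \<nu> * t powr a) \<le> E"
proof -
  define n where "n = nat \<lceil>s / a\<rceil>"
  have "s / a \<le> real n" unfolding n_def by linarith
  hence n: "s \<le> a * real n" using assms by (simp add: field_simps)
  define E where "E = 2 powr s * (1 + fact n / \<nu> ^ n)"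
  have "(1 + t) powr s * exp (- \<nu> * t powr a) \<le> E" if t: "0 \<le> t" for t
  proof (cases "t \<le> 1")
    case True
    have "(1 + t) powr s * exp (- \<nu> * t powr a) \<le> 2 powr s * 1"
      using True t assms by (intro mult_mono powr_mono2) auto
    also have "\<dots> \<le> E"
      unfolding E_def using assms by (intro mult_left_mono) auto
    finally show ?thesis .
  next
    case False
    let ?u = "t powr a"
    have "(1 + t) powr s \<le> (2 * t) powr s"
      using False assms by (intro powr_mono2) auto
    also have "\<dots> = 2 powr s * t powr s"
      using False by (simp add: powr_mult)
    also have "\<dots> \<le> 2 powr s * t powr (a * real n)"
      using False n by (intro mult_left_mono powr_mono) auto
    also have "t powr (a * real n) = ?u ^ n"
      using False by (simp add: powr_powr[symmetric] powr_realpow)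
    finally have poly: "(1 + t) powr s \<le> 2 powr s * ?u ^ n" .
    \<comment> \<open>A single term of the exponential series already dominates the power.\<close>
    have "(\<nu> * ?u) ^ n / fact n \<le> exp (\<nu> * ?u)"
    proof -
      have "(\<Sum>i\<in>{n}. (\<nu> * ?u) ^ i /\<^sub>R fact i) \<le> (\<Sum>i. (\<nu> * ?u) ^ i /\<^sub>R fact i)"
        using assms by (intro sum_le_suminf summable_exp_generic) auto
      thus ?thesis by (simp add: exp_def divide_inverse mult_ac)
    qed
    hence "?u ^ n \<le> fact n / \<nu> ^ n * exp (\<nu> * ?u)"
      using assms by (simp add: field_simps power_mult_distrib)
    hence "2 powr s * ?u ^ n \<le> 2 powr s * (fact n / \<nu> ^ n * exp (\<nu> * ?u))"
      by (intro mult_left_mono) auto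
    with poly have "(1 + t) powr s \<le> 2 powr s * (fact n / \<nu> ^ n) * exp (\<nu> * ?u)"
      by simp
    hence "(1 + t) powr s * exp (- \<nu> * ?u)
        \<le> 2 powr s * (fact n / \<nu> ^ n) * exp (\<nu> * ?u) * exp (- \<nu> * ?u)"
      by (intro mult_right_mono) auto
    also have "\<dots> = 2 powr s * (fact n / \<nu> ^ n)"
      by (simp add: exp_minus field_simps)
    also have "\<dots> \<le> E"
      unfolding E_def by (simp add: algebra_simps)
    finally show ?thesis .
  qed
  moreover have "0 < E"
    unfolding E_def using assms by (intro mult_pos_pos add_pos_nonneg) auto
  ultimately show thesis by (rule that[rotated])
qed

section \<open>Reference points\<close>

lemma reference_points_subset_space:
  assumes "reference_points M d \<delta> Xp"
  shows "Xp k \<subseteq> space M"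
proof (cases "k \<ge> 0")
  case True
  then consider "k = 0" | "k \<ge> 1" by linarith
  hence "\<exists>s. maximal_separated d s (space M) (Xp k)"
    using assms unfolding reference_points_def by cases blast+
  thus ?thesis unfolding maximal_separated_def by blast
next
  case False
  have "Xp (- int n) \<subseteq> space M" for n
  proof (induction n)
    case 0
    have "maximal_separated d 1 (space M) (Xp 0)"
      using assms unfolding reference_points_def by blast
    thus ?case unfolding maximal_separated_def by simp
  next
    case (Suc n)
    have "\<forall>j\<ge>1. maximal_separated d (\<delta> powi (- j)) (Xp (- (j - 1))) (Xp (- j))"
      using assms unfolding reference_points_def by blast
    from this[rule_format, of "int (Suc n)"]
    have "maximal_separated d (\<delta> powi (- int (Suc n))) (Xp (- int n)) (Xp (- int (Suc n)))"
      by simp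
    hence "Xp (- int (Suc n)) \<subseteq> Xp (- int n)" unfolding maximal_separated_def by blast
    with Suc show ?case by blast
  qed
  from this[of "nat (- k)"] False show ?thesis by simp
qed

section \<open>Volume growth\<close>

context homogeneous_type_space
begin

lemma vol_pos: "x \<in> space M \<Longrightarrow> 0 < r \<Longrightarrow> 0 < vol M d x r"
  using qball_positive[of x r] qball_finite[of x r]
  by (auto simp: vol_def measure_def enn2real_positive_iff)

lemma emeasure_qball_eq_vol:
  "x \<in> space M \<Longrightarrow> 0 < r \<Longrightarrow> emeasure M (qball M d x r) = ennreal (vol M d x r)"
  using qball_finite[of x r] by (simp add: vol_def emeasure_eq_ennreal_measure)

lemma vol_mono:
  assumes "x \<in> space M" "y \<in> space M" "0 < s" "qball M d x r \<subseteq> qball M d y s"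
  shows "vol M d x r \<le> vol M d y s"
proof (cases "0 < r")
  case True
  thus ?thesis
    using assms qball_finite[of y s] unfolding vol_def
    by (intro measure_mono_fmeasurable) (auto simp: qball_sets fmeasurable_def)
next
  case False
  hence "qball M d x r = {}"
    using d_nonneg assms(1) by (fastforce simp: qball_def)
  thus ?thesis by (simp add: vol_def)
qed

text \<open>
  Enlarging the doubling constant to a power \<open>2\<^sup>m\<close> turns \<open>n\<close>-fold doubling into the factor
  \<open>(2\<^sup>n)\<^sup>m\<close>, which is polynomial in the dilation; rounding the dilation up to a power of two
  costs the factor \<open>2\<close>.
\<close>
lemma vol_scale_le:
  obtains m :: nat where
    "\<And>x r l. x \<in> space M \<Longrightarrow> 0 < r \<Longrightarrow> 1 \<le> l \<Longrightarrow> vol M d x (l * r) \<le> (2 * l) ^ m * vol M d x r"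
proof -
  obtain C where C: "\<And>x r. x \<in> space M \<Longrightarrow> 0 < r \<Longrightarrow>
      emeasure M (qball M d x (2 * r)) \<le> ennreal C * emeasure M (qball M d x r)"
    using doubling by blast
  obtain m :: nat where m: "C < 2 ^ m"
    using real_arch_pow[of 2 C] by auto
  have double: "vol M d x (2 * r) \<le> 2 ^ m * vol M d x r" if "x \<in> space M" "0 < r" for x r
  proof -
    have "ennreal (vol M d x (2 * r)) \<le> ennreal C * ennreal (vol M d x r)"
      using C[OF that] that by (simp add: emeasure_qball_eq_vol)
    also have "\<dots> \<le> ennreal (2 ^ m) * ennreal (vol M d x r)"
      using m by (intro mult_right_mono ennreal_leI) auto
    also have "\<dots> = ennreal (2 ^ m * vol M d x r)"
      by (rule ennreal_mult'[symmetric]) simp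
    finally show ?thesis using vol_pos[OF that] by (simp add: ennreal_le_iff)
  qed
  have iter: "vol M d x (2 ^ n * r) \<le> (2 ^ n) ^ m * vol M d x r"
    if "x \<in> space M" "0 < r" for x r n
  proof (induction n)
    case (Suc n)
    have "vol M d x (2 * (2 ^ n * r)) \<le> 2 ^ m * vol M d x (2 ^ n * r)"
      using that by (intro double) auto
    also have "\<dots> \<le> 2 ^ m * ((2 ^ n) ^ m * vol M d x r)"
      using Suc by (intro mult_left_mono) auto
    finally show ?case by (simp add: power_mult_distrib mult.assoc)
  qed simp
  have "vol M d x (l * r) \<le> (2 * l) ^ m * vol M d x r"
    if x: "x \<in> space M" and r: "0 < r" and l: "1 \<le> l" for x r and l :: real
  proof -
    obtain n where "2 ^ n \<le> nat \<lfloor>l\<rfloor>" "nat \<lfloor>l\<rfloor> < 2 ^ (n + 1)"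
      using ex_power_ivl1[of 2 "nat \<lfloor>l\<rfloor>"] l by (auto simp: le_nat_iff)
    hence n: "2 ^ n \<le> l" "l < 2 ^ (n + 1)"
      using l by (simp_all add: le_nat_iff nat_less_iff le_floor_iff floor_less_iff)
    have "vol M d x (l * r) \<le> vol M d x (2 ^ (n + 1) * r)"
    proof (intro vol_mono x)
      have "l * r \<le> 2 ^ (n + 1) * r" using n r by (intro mult_right_mono) auto
      thus "qball M d x (l * r) \<subseteq> qball M d x (2 ^ (n + 1) * r)"
        unfolding qball_def by auto
    qed (use r in auto)
    also have "\<dots> \<le> (2 ^ (n + 1)) ^ m * vol M d x r"
      by (intro iter x r)
    also have "\<dots> \<le> (2 * l) ^ m * vol M d x r"
      using n vol_pos[OF x r] by (intro mult_right_mono power_mono) auto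
    finally show ?thesis .
  qed
  thus thesis by (rule that)
qed

text \<open>
  The ball about \<open>x\<close> of radius \<open>d x x0\<close> lies in the ball about \<open>x0\<close> of radius \<open>2 * A0 * d x x0\<close>,
  so its volume is controlled by that of a dilated ball with the fixed center \<open>x0\<close>.
\<close>
lemma inverse_vol_le_weight:
  obtains K m where "0 < K" "0 \<le> m"
    "\<And>x x0 r \<gamma>. x \<in> space M \<Longrightarrow> x0 \<in> space M \<Longrightarrow> 0 < r \<Longrightarrow>
       1 / vol M d x0 r \<le> K * (1 + d x x0 / r) powr (m + \<gamma>) *
         (1 / (vol M d x0 r + vol M d x (d x x0)) * (r / (r + d x x0)) powr \<gamma>)"
proof -
  obtain m :: nat where m: "\<And>x r l. x \<in> space M \<Longrightarrow> 0 < r \<Longrightarrow> 1 \<le> l \<Longrightarrow>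
      vol M d x (l * r) \<le> (2 * l) ^ m * vol M d x r"
    by (rule vol_scale_le) blast
  define K where "K = 1 + (4 * A0) ^ m"
  have "1 / vol M d x0 r \<le> K * (1 + d x x0 / r) powr (real m + \<gamma>) *
         (1 / (vol M d x0 r + vol M d x (d x x0)) * (r / (r + d x x0)) powr \<gamma>)"
    if x: "x \<in> space M" and x0: "x0 \<in> space M" and r: "0 < r" for x x0 r \<gamma>
  proof -
    define P V W where "P = 1 + d x x0 / r" and "V = vol M d x0 r" and "W = vol M d x (d x x0)"
    have \<rho>: "0 \<le> d x x0" using d_nonneg x x0 by simp
    have P: "1 \<le> P" using \<rho> r by (simp add: P_def)
    have V: "0 < V" unfolding V_def by (intro vol_pos x0 r)
    have W0: "0 \<le> W" by (simp add: W_def vol_def)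
    have AP: "1 \<le> 2 * A0 * P" using A0_ge_1 P mult_mono[of 1 A0 1 P] by simp
    have "W \<le> vol M d x0 (2 * A0 * P * r)"
      unfolding W_def
    proof (intro vol_mono x x0)
      show "0 < 2 * A0 * P * r" using AP r by simp
      show "qball M d x (d x x0) \<subseteq> qball M d x0 (2 * A0 * P * r)"
      proof
        fix z assume "z \<in> qball M d x (d x x0)"
        hence z: "z \<in> space M" "d x z < d x x0" by (auto simp: qball_def)
        have "d x0 z \<le> A0 * (d x0 x + d x z)" using d_quasi_triangle x0 z x by blast
        also have "\<dots> < A0 * (2 * d x x0)"
          using z A0_ge_1 d_sym[OF x x0] by (intro mult_strict_left_mono) auto
        also have "\<dots> \<le> A0 * (2 * (P * r))"
          using A0_ge_1 r by (intro mult_left_mono) (auto simp: P_def field_simps)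
        finally show "z \<in> qball M d x0 (2 * A0 * P * r)"
          using z by (simp add: qball_def mult_ac)
      qed
    qed
    also have "\<dots> \<le> (2 * (2 * A0 * P)) ^ m * V"
      unfolding V_def by (intro m x0 r AP)
    also have "2 * (2 * A0 * P) = (4 * A0) * P" by simp
    also have "\<dots> ^ m * V = (4 * A0) ^ m * P ^ m * V" by (simp only: power_mult_distrib)
    finally have W: "W \<le> (4 * A0) ^ m * P ^ m * V" .
    have "V \<le> P ^ m * V" using P V by simp
    with W have sum_le: "V + W \<le> K * P ^ m * V" by (simp add: K_def algebra_simps)
    have "r / (r + d x x0) = 1 / P" using r \<rho> by (simp add: P_def field_simps)
    hence wt: "(r / (r + d x x0)) powr \<gamma> = 1 / P powr \<gamma>"
      using P by (simp add: powr_divide)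
    have "1 / V \<le> K * P ^ m / (V + W)"
      using sum_le V W0 by (simp add: field_simps)
    also have "\<dots> = K * (P ^ m * P powr \<gamma>) * (1 / (V + W) * (1 / P powr \<gamma>))"
      using P by simp
    also have "P ^ m * P powr \<gamma> = P powr (real m + \<gamma>)"
      using P by (simp add: powr_add powr_realpow)
    finally show ?thesis by (simp add: wt flip: P_def V_def W_def)
  qed
  moreover have "0 < K" unfolding K_def using A0_ge_1 by (simp add: add_pos_nonneg)
  ultimately show thesis using that[of K "real m"] by simp
qed

section \<open>Localized functions as test functions\<close>

text \<open>
  The exponents \<open>\<beta>\<close> of the Hoelder factor and \<open>\<gamma>\<close> of the decay, together with the growth exponent
  of the volume, are paid for by the stretched exponential alone; the far case \<open>r < d x z\<close> of the
  Hoelder condition rests on the size bound at both points.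
\<close>
lemma stretched_exp_localized_in_test_functions:
  fixes f :: "'a \<Rightarrow> complex"
  assumes x0: "x0 \<in> space M" and r: "0 < r"
    and a: "0 < a" and \<nu>: "0 < \<nu>" and \<beta>: "0 \<le> \<beta>" and \<gamma>: "0 \<le> \<gamma>"
    and size: "\<And>x. x \<in> space M \<Longrightarrow>
      cmod (f x) \<le> C / vol M d x0 r * exp (- \<nu> * (d x0 x / r) powr a)"
    and smooth: "\<And>x z. x \<in> space M \<Longrightarrow> z \<in> space M \<Longrightarrow> d x z \<le> r \<Longrightarrow>
      cmod (f x - f z) \<le> C / vol M d x0 r * (d x z / r) powr \<beta> * exp (- \<nu> * (d x0 x / r) powr a)"
    and canc: "has_bochner_integral M f 0"
  shows "f \<in> test_functions M d A0 x0 r \<beta> \<gamma>"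
proof -
  obtain K m where K: "0 < K" and m: "0 \<le> m" and weight_lower:
    "\<And>x x0 r \<gamma>. x \<in> space M \<Longrightarrow> x0 \<in> space M \<Longrightarrow> 0 < r \<Longrightarrow>
       1 / vol M d x0 r \<le> K * (1 + d x x0 / r) powr (m + \<gamma>) *
         (1 / (vol M d x0 r + vol M d x (d x x0)) * (r / (r + d x x0)) powr \<gamma>)"
    by (rule inverse_vol_le_weight) blast
  define s where "s = m + \<gamma> + \<beta>"
  have s: "0 \<le> s" using m \<beta> \<gamma> by (simp add: s_def)
  obtain E where E: "0 < E" and
    decay: "\<And>t. 0 \<le> t \<Longrightarrow> (1 + t) powr s * exp (- \<nu> * t powr a) \<le> E"
    using powr_times_stretched_exp_bounded[OF a \<nu> s] by blast
  define V P e w where "V = vol M d x0 r" and "P = (\<lambda>x. 1 + d x x0 / r)"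
    and "e = (\<lambda>x. exp (- \<nu> * (d x x0 / r) powr a))"
    and "w = (\<lambda>x. 1 / (vol M d x0 r + vol M d x (d x x0)) * (r / (r + d x x0)) powr \<gamma>)"
  \<comment> \<open>The summand \<open>(2 * A0) powr s\<close> is the price of replacing \<open>P x\<close> by \<open>P z\<close> in the far case.\<close>
  define B where "B = C * E * (1 + (2 * A0) powr s)"
  have V: "0 < V" unfolding V_def by (intro vol_pos x0 r)
  have C: "0 \<le> C"
  proof -
    have "d x0 x0 = 0" using d_zero_iff x0 by simp
    hence "0 \<le> C / V"
      using order_trans[OF norm_ge_zero size[OF x0]] by (simp add: V_def)
    thus ?thesis using V by (simp add: zero_le_divide_iff)
  qed
  have P: "1 \<le> P x" if "x \<in> space M" for x
    using d_nonneg[OF that x0] r by (simp add: P_def)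
  have decay': "P x powr s * e x \<le> E" if "x \<in> space M" for x
    unfolding P_def e_def using d_nonneg[OF that x0] r by (intro decay) simp
  have size': "V * cmod (f x) \<le> C * e x" if "x \<in> space M" for x
    using size[OF that] V d_sym[OF that x0] by (simp add: V_def e_def field_simps)
  have smooth': "V * cmod (f x - f z) \<le> C * (d x z / r) powr \<beta> * e x"
    if "x \<in> space M" "z \<in> space M" "d x z \<le> r" for x z
    using smooth[OF that] V d_sym[OF that(1) x0] by (simp add: V_def e_def field_simps)
  have to_weight: "q \<le> b * K * w x"
    if "x \<in> space M" "0 \<le> q" "V * q * P x powr (m + \<gamma>) \<le> b" for x q b
  proof -
    have w0: "0 \<le> w x" by (simp add: w_def vol_def)
    have "q = 1 / V * (V * q)" using V by simp
    also have "\<dots> \<le> K * P x powr (m + \<gamma>) * w x * (V * q)"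
      using weight_lower[OF that(1) x0 r, of \<gamma>] that V
      by (intro mult_right_mono) (auto simp: V_def P_def w_def)
    also have "\<dots> = (V * q * P x powr (m + \<gamma>)) * (K * w x)" by (simp add: mult_ac)
    also have "\<dots> \<le> b * (K * w x)"
      using that K w0 by (intro mult_right_mono) auto
    finally show ?thesis by (simp add: mult_ac)
  qed
  have CE: "C * E \<le> B"
    using C E by (simp add: B_def algebra_simps)
  have size_weight: "cmod (f x) \<le> B * K * w x" if x: "x \<in> space M" for x
  proof (rule to_weight[OF x])
    have "V * cmod (f x) * P x powr (m + \<gamma>) \<le> (C * e x) * P x powr s"
      using P[OF x] C \<beta> by (intro mult_mono[OF size'[OF x]] powr_mono) (auto simp: s_def e_def)
    also have "\<dots> = C * (P x powr s * e x)" by (simp add: mult_ac)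
    also have "\<dots> \<le> C * E" using decay'[OF x] C by (intro mult_left_mono) auto
    finally show "V * cmod (f x) * P x powr (m + \<gamma>) \<le> B" using CE by linarith
  qed simp
  have smooth_weight: "cmod (f x - f z) \<le> B * (d x z / (r + d x x0)) powr \<beta> * K * w x"
    if x: "x \<in> space M" and z: "z \<in> space M"
      and near: "d x z < inverse (2 * A0) * (r + d x x0)" for x z
  proof (rule to_weight[OF x])
    let ?h = "(d x z / (r + d x x0)) powr \<beta>"
    have D: "0 \<le> d x z" by (intro d_nonneg x z)
    have \<rho>: "0 \<le> d x x0" by (intro d_nonneg x x0)
    have "P x = (r + d x x0) / r" using r by (simp add: P_def add_divide_distrib)
    hence "d x z / r = P x * (d x z / (r + d x x0))" using r \<rho> by simp
    hence h: "(d x z / r) powr \<beta> = P x powr \<beta> * ?h"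
      using P[OF x] D r \<rho> by (simp add: powr_mult del: times_divide_eq_right)
    have Ps: "P x powr (m + \<gamma>) * P x powr \<beta> = P x powr s"
      by (simp add: s_def powr_add)
    show "V * cmod (f x - f z) * P x powr (m + \<gamma>) \<le> B * ?h"
    proof (cases "d x z \<le> r")
      case True
      have "V * cmod (f x - f z) * P x powr (m + \<gamma>)
          \<le> C * (P x powr \<beta> * ?h) * e x * P x powr (m + \<gamma>)"
        using smooth'[OF x z True] by (intro mult_right_mono) (auto simp: h)
      also have "\<dots> = C * (P x powr s * e x) * ?h" by (simp add: Ps[symmetric] mult_ac)
      also have "\<dots> \<le> C * E * ?h"
        using decay'[OF x] C by (intro mult_right_mono mult_left_mono) auto
      also have "\<dots> \<le> B * ?h" using CE by (intro mult_right_mono) auto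
      finally show ?thesis .
    next
      case False
      have "1 \<le> d x z / r" using False r by simp
      hence one_le: "1 \<le> P x powr \<beta> * ?h"
        unfolding h[symmetric] using \<beta> by (rule ge_one_powr_ge_zero)
      have "d x x0 \<le> A0 * (d x z + d z x0)" by (intro d_quasi_triangle x x0 z)
      moreover have "2 * (A0 * d x z) < r + d x x0"
        using near A0_ge_1 by (simp add: field_simps)
      ultimately have "d x x0 \<le> r + 2 * A0 * d z x0" by (simp add: algebra_simps)
      hence "d x x0 / r \<le> (r + 2 * A0 * d z x0) / r" using r by (intro divide_right_mono) auto
      hence "P x \<le> 2 + 2 * A0 * (d z x0 / r)" using r by (simp add: P_def add_divide_distrib)
      also have "\<dots> \<le> 2 * A0 * P z" using A0_ge_1 by (simp add: P_def algebra_simps)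
      finally have "P x powr s \<le> (2 * A0 * P z) powr s"
        using P[OF x] s by (intro powr_mono2) auto
      also have "\<dots> = (2 * A0) powr s * P z powr s"
        using A0_ge_1 P[OF z] by (simp add: powr_mult)
      finally have "P x powr s * e z \<le> (2 * A0) powr s * P z powr s * e z"
        by (intro mult_right_mono) (auto simp: e_def)
      also have "\<dots> \<le> (2 * A0) powr s * E"
        using mult_left_mono[OF decay'[OF z], of "(2 * A0) powr s"] by (simp add: mult_ac)
      finally have ez: "P x powr s * e z \<le> (2 * A0) powr s * E" .
      have "V * cmod (f x - f z) \<le> V * (cmod (f x) + cmod (f z))"
        using V norm_triangle_ineq4 by (intro mult_left_mono) auto
      also have "\<dots> \<le> C * (e x + e z)"
        using size'[OF x] size'[OF z] by (simp add: algebra_simps)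
      also have "\<dots> \<le> C * (e x + e z) * (P x powr \<beta> * ?h)"
        using one_le C mult_left_mono[OF one_le, of "C * (e x + e z)"] by (simp add: e_def)
      finally have "V * cmod (f x - f z) * P x powr (m + \<gamma>)
          \<le> C * (e x + e z) * (P x powr \<beta> * ?h) * P x powr (m + \<gamma>)"
        by (intro mult_right_mono) auto
      also have "\<dots> = C * (P x powr s * e x + P x powr s * e z) * ?h"
        by (simp add: Ps[symmetric] algebra_simps)
      also have "\<dots> \<le> C * (E + (2 * A0) powr s * E) * ?h"
        using decay'[OF x] ez C by (intro mult_right_mono mult_left_mono add_mono) auto
      also have "\<dots> = B * ?h" by (simp add: B_def algebra_simps)
      finally show ?thesis .
    qed
  qed simp
  \<comment> \<open>The constant must be positive also when \<open>C = 0\<close>.\<close>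
  define B' where "B' = B * K + 1"
  have BK: "0 \<le> B * K" using C E K by (simp add: B_def)
  have w0: "0 \<le> w x" for x by (simp add: w_def vol_def)
  have "cmod (f x) \<le> B' * w x" if "x \<in> space M" for x
    using size_weight[OF that] w0[of x] by (simp add: B'_def algebra_simps)
  moreover have "cmod (f x - f z) \<le> B' * (d x z / (r + d x x0)) powr \<beta> * w x"
    if "x \<in> space M" "z \<in> space M" "d x z < inverse (2 * A0) * (r + d x x0)" for x z
  proof -
    have "0 \<le> (d x z / (r + d x x0)) powr \<beta> * w x" using w0 by simp
    thus ?thesis using smooth_weight[OF that] by (simp add: B'_def algebra_simps)
  qed
  moreover have "0 < B'" using BK by (simp add: B'_def)
  ultimately show ?thesis
    using canc unfolding test_functions_def w_def
    by (intro CollectI conjI exI[of _ B']) (auto simp: mult.assoc)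
qed

end

section \<open>Scaled wavelets\<close>

theorem theorem3p3:
  fixes M :: "'a measure" and d :: "'a \<Rightarrow> 'a \<Rightarrow> real" and A0 \<delta> \<eta> \<gamma> :: real
    and Xp :: "int \<Rightarrow> 'a set" and \<psi> :: "int \<Rightarrow> 'a \<Rightarrow> 'a \<Rightarrow> complex"
    and k :: int and y :: 'a
  assumes "homogeneous_type_space M d A0"
    and "0 < \<delta>" and "\<delta> < 1"
    and "reference_points M d \<delta> Xp"
    and "0 < \<eta>" and "\<eta> \<le> 1"
    and "wavelet_basis M d A0 \<delta> Xp \<eta> \<psi>"
    and "y \<in> wavelet_centers Xp k"
    and "0 < \<gamma>"
  shows "(\<lambda>x. \<psi> k y x / complex_of_real (sqrt (vol M d y (\<delta> powi k))))
           \<in> test_functions M d A0 y (\<delta> powi k) \<eta> \<gamma>"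
proof -
  interpret homogeneous_type_space M d A0 by fact
  define r where "r = \<delta> powi k"
  define V where "V = vol M d y r"
  define a where "a = inverse (1 + 2 * log 2 A0)"
  have r: "0 < r" using assms(2) by (simp add: r_def)
  have y: "y \<in> space M"
    using assms(8) reference_points_subset_space[OF assms(4)] by (auto simp: wavelet_centers_def)
  have V: "0 < V" unfolding V_def by (intro vol_pos y r)
  have "0 \<le> log 2 A0" using A0_ge_1 by simp
  hence a: "0 < a" by (simp add: a_def)
  obtain C \<nu> where \<nu>: "0 < \<nu>" and bounds: "\<forall>k. \<forall>y\<in>wavelet_centers Xp k.
      (\<forall>x\<in>space M. cmod (\<psi> k y x)
         \<le> C * vol M d y (\<delta> powi k) powr (- 1 / 2) * exp (- \<nu> * (d y x / \<delta> powi k) powr a)) \<and>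
      (\<forall>x\<in>space M. \<forall>z\<in>space M. d x z \<le> \<delta> powi k \<longrightarrow> cmod (\<psi> k y x - \<psi> k y z)
         \<le> C * vol M d y (\<delta> powi k) powr (- 1 / 2) * (d x z / \<delta> powi k) powr \<eta> *
             exp (- \<nu> * (d y x / \<delta> powi k) powr a))"
    using assms(7)[unfolded wavelet_basis_def Let_def, folded a_def] by (elim conjE exE) (rule that)
  have size: "\<And>x. x \<in> space M \<Longrightarrow>
      cmod (\<psi> k y x) \<le> C * V powr (- 1 / 2) * exp (- \<nu> * (d y x / r) powr a)"
    and smooth: "\<And>x z. x \<in> space M \<Longrightarrow> z \<in> space M \<Longrightarrow> d x z \<le> r \<Longrightarrow>
      cmod (\<psi> k y x - \<psi> k y z)
        \<le> C * V powr (- 1 / 2) * (d x z / r) powr \<eta> * exp (- \<nu> * (d y x / r) powr a)"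
    using bspec[OF spec[OF bounds] assms(8)] unfolding V_def r_def by simp_all
  have canc: "has_bochner_integral M (\<psi> k y) 0"
    using assms(7,8) unfolding wavelet_basis_def by blast
  have V_powr: "V powr (- 1 / 2) = 1 / sqrt V"
    using V powr_minus_divide[of V "1 / 2"] by (simp add: powr_half_sqrt)
  have norm_scaled: "cmod (c / complex_of_real (sqrt V)) = cmod c * V powr (- 1 / 2)" for c
    unfolding V_powr using V by (simp add: norm_divide)
  have V_half: "V powr (- 1 / 2) * V powr (- 1 / 2) = 1 / V"
    unfolding V_powr using V by simp
  have "(\<lambda>x. \<psi> k y x / complex_of_real (sqrt V)) \<in> test_functions M d A0 y r \<eta> \<gamma>"
  proof (rule stretched_exp_localized_in_test_functions[OF y r a \<nu>])
    fix x assume x: "x \<in> space M"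
    let ?e = "exp (- \<nu> * (d y x / r) powr a)"
    have "cmod (\<psi> k y x) * V powr (- 1 / 2) \<le> C * V powr (- 1 / 2) * ?e * V powr (- 1 / 2)"
      by (intro mult_right_mono size x) simp
    also have "\<dots> = C * (V powr (- 1 / 2) * V powr (- 1 / 2)) * ?e" by (simp only: mult_ac)
    finally show "cmod (\<psi> k y x / complex_of_real (sqrt V)) \<le> C / vol M d y r * ?e"
      unfolding norm_scaled V_half by (simp add: V_def)
  next
    fix x z assume xz: "x \<in> space M" "z \<in> space M" "d x z \<le> r"
    let ?h = "(d x z / r) powr \<eta>" and ?e = "exp (- \<nu> * (d y x / r) powr a)"
    have "cmod (\<psi> k y x - \<psi> k y z) * V powr (- 1 / 2)
        \<le> C * V powr (- 1 / 2) * ?h * ?e * V powr (- 1 / 2)"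
      by (intro mult_right_mono smooth xz) simp
    also have "\<dots> = C * (V powr (- 1 / 2) * V powr (- 1 / 2)) * ?h * ?e" by (simp only: mult_ac)
    finally show "cmod (\<psi> k y x / complex_of_real (sqrt V) - \<psi> k y z / complex_of_real (sqrt V))
        \<le> C / vol M d y r * ?h * ?e"
      unfolding diff_divide_distrib[symmetric] norm_scaled V_half by (simp add: V_def)
  next
    have "V \<noteq> 0" using V by simp
    thus "has_bochner_integral M (\<lambda>x. \<psi> k y x / complex_of_real (sqrt V)) 0"
      using has_bochner_integral_divide_zero[OF canc, of "complex_of_real (sqrt V)"] by simp
  qed (use assms in auto)
  thus ?thesis by (simp only: V_def r_def)
qed

end
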